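(* Let $\rho=\tfrac12(I+\mathbf r\cdot\boldsymbol\sigma)$ and $\sigma=\tfrac12(I+\mathbf s\cdot\boldsymbol\sigma)$ be qubit states with $\mathbf r,\mathbf s\in\mathbb{R}^3$, $|\mathbf r|,|\mathbf s|\le1$, and let $t\in[0,1]$. (a) If $\rho$ is pure ($|\mathbf r|=1$), then $$p=\operatorname{Tr}(\rho\sigma)=\tfrac14\operatorname{Tr}\Big(I+\mathbf r\cdot\boldsymbol\sigma+\mathbf s\cdot\boldsymbol\sigma+(\mathbf r\cdot\boldsymbol\sigma)(\mathbf s\cdot\boldsymbol\sigma)\Big)=\tfrac12\big(1+\mathbf r\cdot\mathbf s\big),$$ where $p=\langle\psi|\sigma|\psi\rangle$ for $\rho=|\psi\rangle\langle\psi|$, and hence $$\mathsf{F}_{\mathrm U}(\rho,\sigma)=\sqrt{\tfrac{1+\mathbf r\cdot\mathbf s}{2}},\qquad \mathsf{F}_{\mathrm M}(\rho,\sigma)=\sqrt{\tfrac{1+\mathbf r\cdot\mathbf s}{2}},\qquad \mathsf{F}_t^{\mathrm{spec}}(\rho,\sigma)=\Big(\tfrac{1+\mathbf r\cdot\mathbf s}{2}\Big)^{t}.$$ (b) If both are pure with Bloch angle $\theta\in[0,\pi]$ (so $\mathbf r\cdot\mathbf s=\cos\theta$), then $$\mathsf{F}_{\mathrm U}(\rho,\sigma)=\cos(\theta/2),\qquad \mathsf{F}_t^{\mathrm{spec}}(\rho,\sigma)=\cos^{2t}(\theta/2).$$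
   Context: $\boldsymbol\sigma=(\sigma_x,\sigma_y,\sigma_z)$ is the vector of Pauli matrices, $\mathbf r\cdot\boldsymbol\sigma=r_x\sigma_x+r_y\sigma_y+r_z\sigma_z$, and the qubit states are positive semidefinite $2\times2$ complex matrices of trace one. The matrix geometric mean is $A\sharp B=A^{1/2}(A^{-1/2}BA^{-1/2})^{1/2}A^{1/2}$. The fidelities are: Uhlmann (root) $\mathsf{F}_{\mathrm U}(\rho,\sigma)=\operatorname{Tr}\sqrt{\rho^{1/2}\sigma\rho^{1/2}}$; Matsumoto $\mathsf{F}_{\mathrm M}(\rho,\sigma)=\operatorname{Tr}(\rho\sharp\sigma)$; weighted spectral $\mathsf{F}_t^{\mathrm{spec}}(\rho,\sigma)=\operatorname{Tr}\big(\rho\,(\rho^{-1}\sharp\sigma)^{2t}\big)$. All inverse and fractional powers are interpreted on the support of the corresponding operator (zero on its kernel); in particular for a rank-one state $\rho$ the operators $\rho^{1/2},\rho^{-1/2},\rho^{-1}$ all coincide with $\rho$. Also $X^0=I$ and $0^0=1$. *)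

theory Defs
  imports "HOL-Analysis.Analysis"
begin

definition cadj :: "complex^'n^'m \<Rightarrow> complex^'m^'n" where
  "cadj A = (\<chi> i j. cnj (A $ j $ i))"

(* The library's inner product on complex^'n is the real one (the real part of this);
   this one is antilinear in the first argument. *)
definition braket :: "complex^'n \<Rightarrow> complex^'n \<Rightarrow> complex" where
  "braket \<phi> \<psi> = (\<Sum>i\<in>UNIV. cnj (\<phi> $ i) * \<psi> $ i)"

definition ketbra :: "complex^'n \<Rightarrow> complex^'n \<Rightarrow> complex^'n^'n" where
  "ketbra \<phi> \<psi> = (\<chi> i j. \<phi> $ i * cnj (\<psi> $ j))"

definition unitary :: "complex^'n^'n \<Rightarrow> bool" where
  "unitary U \<longleftrightarrow> cadj U ** U = mat 1 \<and> U ** cadj U = mat 1"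

definition psd :: "complex^'n^'n \<Rightarrow> bool" where
  "psd A \<longleftrightarrow> cadj A = A \<and> (\<forall>x. 0 \<le> Re (braket x (A *v x)))"

definition state :: "complex^'n^'n \<Rightarrow> bool" where
  "state \<rho> \<longleftrightarrow> psd \<rho> \<and> trace \<rho> = 1"

definition pure_state :: "complex^'n^'n \<Rightarrow> bool" where
  "pure_state \<rho> \<longleftrightarrow> (\<exists>\<psi>. norm \<psi> = 1 \<and> \<rho> = ketbra \<psi> \<psi>)"

(* Real powers of x \<ge> 0 with x^0 = 1 (also for x = 0), and 0^a = 0 for a \<noteq> 0, negative a included.
   The library's powr agrees except that 0 powr 0 = 0. *)
definition rpow :: "real \<Rightarrow> real \<Rightarrow> real" where
  "rpow x a = (if a = 0 then 1 else x powr a)"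

definition rdiag :: "('n \<Rightarrow> real) \<Rightarrow> complex^'n^'n" where
  "rdiag d = (\<chi> i j. if i = j then complex_of_real (d i) else 0)"

(* The power A^a of a positive semidefinite A by functional calculus. By the convention in rpow,
   powers with a \<noteq> 0 are taken on the support of A and vanish on its kernel, while A^0 = I.
   The result does not depend on the chosen diagonalisation, see mpow_eqI. *)
definition mpow :: "complex^'n^'n \<Rightarrow> real \<Rightarrow> complex^'n^'n" where
  "mpow A a = (THE B. \<exists>U d. unitary U \<and> (\<forall>i. 0 \<le> d i) \<and> A = U ** rdiag d ** cadj U \<and>
     B = U ** rdiag (\<lambda>i. rpow (d i) a) ** cadj U)"

lemma diagonalisation_fun_unique:
  fixes U V :: "complex^'n^'n"
  assumes U: "unitary U" and V: "unitary V"
    and eq: "U ** rdiag d ** cadj U = V ** rdiag e ** cadj V"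
  shows "U ** rdiag (\<lambda>i. f (d i)) ** cadj U = V ** rdiag (\<lambda>i. f (e i)) ** cadj V"
proof -
  define W where "W = cadj V ** U"
  have r: "(M ** rdiag g) $ i $ j = M $ i $ j * complex_of_real (g j)"
    and l: "(rdiag g ** M) $ i $ j = complex_of_real (g i) * M $ i $ j"
    for M :: "complex^'n^'n" and g i j
    by (simp_all add: matrix_matrix_mult_def rdiag_def if_distrib if_distribR cong: if_cong)
  have 1: "cadj V ** (U ** rdiag g ** cadj U) ** U = W ** rdiag g" for g
    using U by (simp add: unitary_def W_def matrix_mul_assoc [symmetric])
  have 2: "cadj V ** (V ** rdiag g ** cadj V) ** U = rdiag g ** W" for g
    using V by (metis (no_types, lifting) unitary_def W_def matrix_mul_assoc matrix_mul_lid)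
  have "W ** rdiag d = rdiag e ** W"
    using 1 2 eq by metis
  then have "W $ i $ j * complex_of_real (d j) = complex_of_real (e i) * W $ i $ j" for i j
    by (metis r l)
  then have "W $ i $ j = 0 \<or> d j = e i" for i j
    by (metis mult.commute mult_cancel_right of_real_eq_iff)
  then have "W $ i $ j * complex_of_real (f (d j)) = complex_of_real (f (e i)) * W $ i $ j" for i j
    by (metis mult.commute mult_zero_left)
  then have "W ** rdiag (\<lambda>i. f (d i)) = rdiag (\<lambda>i. f (e i)) ** W"
    by (simp add: vec_eq_iff r l)
  then have "V ** (W ** rdiag (\<lambda>i. f (d i))) ** cadj U = V ** (rdiag (\<lambda>i. f (e i)) ** W) ** cadj U"
    by simp
  moreover have "V ** W = U" "W ** cadj U = cadj V"
    using U V by (metis unitary_def W_def matrix_mul_assoc matrix_mul_lid matrix_mul_rid)+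
  ultimately show ?thesis
    by (metis matrix_mul_assoc)
qed

lemma mpow_eqI:
  assumes "unitary U" "\<And>i. 0 \<le> d i" "A = U ** rdiag d ** cadj U"
  shows "mpow A a = U ** rdiag (\<lambda>i. rpow (d i) a) ** cadj U"
  unfolding mpow_def
proof (rule the_equality)
  show "\<exists>V e. unitary V \<and> (\<forall>i. 0 \<le> e i) \<and> A = V ** rdiag e ** cadj V \<and>
     U ** rdiag (\<lambda>i. rpow (d i) a) ** cadj U = V ** rdiag (\<lambda>i. rpow (e i) a) ** cadj V"
    using assms by blast
next
  fix B
  assume "\<exists>V e. unitary V \<and> (\<forall>i. 0 \<le> e i) \<and> A = V ** rdiag e ** cadj V \<and>
     B = V ** rdiag (\<lambda>i. rpow (e i) a) ** cadj V"
  then obtain V e where V: "unitary V" "A = V ** rdiag e ** cadj V"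
    and B: "B = V ** rdiag (\<lambda>i. rpow (e i) a) ** cadj V"
    by blast
  show "B = U ** rdiag (\<lambda>i. rpow (d i) a) ** cadj U"
    unfolding B using V assms
    by (intro diagonalisation_fun_unique [where f = "\<lambda>x. rpow x a"]) auto
qed

definition gmean :: "complex^'n^'n \<Rightarrow> complex^'n^'n \<Rightarrow> complex^'n^'n" where
  "gmean A B = mpow A (1/2) ** mpow (mpow A (-1/2) ** B ** mpow A (-1/2)) (1/2) ** mpow A (1/2)"

definition F_U :: "complex^'n^'n \<Rightarrow> complex^'n^'n \<Rightarrow> complex" where
  "F_U \<rho> \<sigma> = trace (mpow (mpow \<rho> (1/2) ** \<sigma> ** mpow \<rho> (1/2)) (1/2))"

definition F_M :: "complex^'n^'n \<Rightarrow> complex^'n^'n \<Rightarrow> complex" where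
  "F_M \<rho> \<sigma> = trace (gmean \<rho> \<sigma>)"

definition F_spec :: "real \<Rightarrow> complex^'n^'n \<Rightarrow> complex^'n^'n \<Rightarrow> complex" where
  "F_spec t \<rho> \<sigma> = trace (\<rho> ** mpow (gmean (mpow \<rho> (-1)) \<sigma>) (2 * t))"

definition sigma_x :: "complex^2^2" where
  "sigma_x = vector [vector [0, 1], vector [1, 0]]"

definition sigma_y :: "complex^2^2" where
  "sigma_y = vector [vector [0, -\<i>], vector [\<i>, 0]]"

definition sigma_z :: "complex^2^2" where
  "sigma_z = vector [vector [1, 0], vector [0, -1]]"

definition pauli_dot :: "real^3 \<Rightarrow> complex^2^2" where
  "pauli_dot r = (r $ 1) *\<^sub>R sigma_x + (r $ 2) *\<^sub>R sigma_y + (r $ 3) *\<^sub>R sigma_z"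

lemma state_bloch:
  assumes "norm r \<le> 1"
  shows "state ((1/2) *\<^sub>R (mat 1 + pauli_dot r))"
proof -
  let ?\<rho> = "(1/2) *\<^sub>R (mat 1 + pauli_dot r)"
  have "cadj ?\<rho> = ?\<rho>"
    by (simp add: vec_eq_iff forall_2 cadj_def mat_def pauli_dot_def sigma_x_def sigma_y_def
        sigma_z_def complex_eq_iff)
  moreover have "trace ?\<rho> = 1"
    by (simp add: trace_def sum_2 mat_def pauli_dot_def sigma_x_def sigma_y_def sigma_z_def
        complex_eq_iff field_simps)
  moreover have "0 \<le> Re (braket x (?\<rho> *v x))" for x
  proof -
    define a b c d where abcd: "a = Re (x$1)" "b = Im (x$1)" "c = Re (x$2)" "d = Im (x$2)"
    define v :: "real^3" where
      "v = vector [2 * (a*c + b*d), 2 * (a*d - b*c), a\<^sup>2 + b\<^sup>2 - c\<^sup>2 - d\<^sup>2]"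
    define N where "N = a\<^sup>2 + b\<^sup>2 + c\<^sup>2 + d\<^sup>2"
    have "(norm v)\<^sup>2 = N\<^sup>2"
      unfolding power2_norm_eq_inner inner_vec_def sum_3 v_def N_def
      by (simp add: power2_eq_square) algebra
    then have "norm v = N"
      by (simp add: N_def)
    then have "\<bar>r \<bullet> v\<bar> \<le> N"
      using Cauchy_Schwarz_ineq2 [of r v] mult_right_mono [OF assms, of N] by (simp add: N_def)
    then have "0 \<le> (N + r \<bullet> v) / 2"
      by (simp add: abs_le_iff)
    moreover have "Re (braket x (?\<rho> *v x)) = (N + r \<bullet> v) / 2"
      by (simp add: braket_def matrix_vector_mult_def sum_2 mat_def pauli_dot_def sigma_x_def
          sigma_y_def sigma_z_def N_def v_def inner_vec_def sum_3 abcd power2_eq_square field_simps)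
    ultimately show ?thesis
      by (simp only:)
  qed
  ultimately show ?thesis
    by (simp add: state_def psd_def)
qed

end

theory Submission imports Defs begin

text \<open>
  A pure state \<open>\<rho> = |\<psi>\<rangle>\<langle>\<psi>|\<close> is a rank-one projector, and two facts about such a projector \<open>P\<close>
  collapse all three fidelities to functions of the single number \<open>p = \<langle>\<psi>|\<sigma>|\<psi>\<rangle>\<close>.
  First, compression to its range is multiplication by a scalar: \<open>P \<sigma> P = p P\<close>
  (lemma \<open>ketbra_compression\<close>). Second, for \<open>c \<ge> 0\<close> the functional calculus on the support gives
  \<open>(c P)\<^sup>a = c\<^sup>a P\<close> when \<open>a \<noteq> 0\<close> (lemma \<open>mpow_scaled_ketbra\<close>); in particular every nonzero power
  of \<open>\<rho>\<close>, negative ones included, is \<open>\<rho>\<close> itself. Hence the square roots occurring in the Uhlmann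
  and Matsumoto fidelities, and the mean \<open>\<rho>\<^sup>-\<^sup>1 \<sharp> \<sigma>\<close>, are all equal to \<open>\<surd>p \<rho>\<close>. The traces
  are then \<open>\<surd>p\<close>, \<open>\<surd>p\<close> and \<open>(\<surd>p)\<^bsup>2t\<^esup> = p\<^sup>t\<close>.

  On the Bloch sphere \<open>Tr (\<rho> \<sigma>) = (1 + r \<bullet> s) / 2\<close>, by the product rule for Pauli matrices. This
  number equals \<open>p\<close>, and for equal arguments it is the purity \<open>(1 + |r|\<^sup>2) / 2\<close>, which forces
  \<open>|r| = 1\<close> for a pure state. For two pure states at Bloch angle \<open>\<theta>\<close>, the half-angle formula
  turns \<open>(1 + cos \<theta>) / 2\<close> into \<open>cos\<^sup>2 (\<theta>/2)\<close>.
\<close>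

section \<open>Rank-one operators\<close>

lemma trace_scaleR: "trace (c *\<^sub>R A) = complex_of_real c * trace (A :: complex^'n^'n)"
  by (simp add: trace_def scaleR_conv_of_real [where 'a = complex] sum_distrib_left)

lemma braket_self: "braket \<psi> \<psi> = complex_of_real ((norm \<psi>)\<^sup>2)"
  by (simp add: braket_def norm_vec_def L2_set_def sum_nonneg mult.commute flip: complex_norm_square)

lemma trace_ketbra: "trace (ketbra \<psi> \<psi>) = braket \<psi> \<psi>"
  by (simp add: trace_def ketbra_def braket_def mult.commute)

lemma trace_ketbra_mult:
  fixes A :: "complex^'n^'n"
  shows "trace (ketbra \<psi> \<psi> ** A) = braket \<psi> (A *v \<psi>)"
proof -
  have "trace (ketbra \<psi> \<psi> ** A) = (\<Sum>i\<in>UNIV. \<Sum>k\<in>UNIV. cnj (\<psi> $ k) * (A $ k $ i * \<psi> $ i))"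
    by (simp add: trace_def matrix_matrix_mult_def ketbra_def mult_ac)
  also have "\<dots> = braket \<psi> (A *v \<psi>)"
    by (subst sum.swap) (simp add: braket_def matrix_vector_mult_def sum_distrib_left)
  finally show ?thesis .
qed

lemma ketbra_compression:
  fixes A :: "complex^'n^'n"
  assumes "braket \<psi> (A *v \<psi>) = complex_of_real p"
  shows "ketbra \<psi> \<psi> ** A ** ketbra \<psi> \<psi> = p *\<^sub>R ketbra \<psi> \<psi>"
proof -
  have "(ketbra \<psi> \<psi> ** A ** ketbra \<psi> \<psi>) $ i $ j = braket \<psi> (A *v \<psi>) * (\<psi> $ i * cnj (\<psi> $ j))"
    for i j
  proof -
    have "(ketbra \<psi> \<psi> ** A ** ketbra \<psi> \<psi>) $ i $ j =
        (\<Sum>l\<in>UNIV. \<Sum>k\<in>UNIV. cnj (\<psi> $ k) * (A $ k $ l * \<psi> $ l)) * (\<psi> $ i * cnj (\<psi> $ j))"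
      by (simp add: matrix_matrix_mult_def ketbra_def sum_distrib_left sum_distrib_right mult_ac)
    also have "(\<Sum>l\<in>UNIV. \<Sum>k\<in>UNIV. cnj (\<psi> $ k) * (A $ k $ l * \<psi> $ l)) = braket \<psi> (A *v \<psi>)"
      by (subst sum.swap) (simp add: braket_def matrix_vector_mult_def sum_distrib_left)
    finally show ?thesis .
  qed
  then show ?thesis
    unfolding assms by (simp add: vec_eq_iff ketbra_def scaleR_conv_of_real [where 'a = complex])
qed

lemma ketbra_idempotent:
  assumes "norm \<psi> = 1"
  shows "ketbra \<psi> \<psi> ** ketbra \<psi> \<psi> = ketbra \<psi> (\<psi> :: complex^'n)"
  using ketbra_compression [of \<psi> "mat 1" 1] assms by (simp add: braket_self)

section \<open>Powers of rank-one qubit operators\<close>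

text \<open>
  In two dimensions a unit vector is completed to an orthonormal basis by an explicit formula,
  \<open>(\<psi>\<^sub>1, \<psi>\<^sub>2) \<mapsto> (- cnj \<psi>\<^sub>2, cnj \<psi>\<^sub>1)\<close>. The same \<open>U\<close> serves all multiples \<open>c\<close> of the projector,
  so it diagonalises an operator together with its powers.
\<close>

lemma scaled_ketbra_diagonalisation:
  fixes \<psi> :: "complex^2"
  assumes "norm \<psi> = 1"
  obtains U :: "complex^2^2" where "unitary U"
    and "\<And>c. c *\<^sub>R ketbra \<psi> \<psi> = U ** rdiag (\<lambda>i. if i = 1 then c else 0) ** cadj U"
proof
  define U :: "complex^2^2" where
    "U = vector [vector [\<psi> $ 1, - cnj (\<psi> $ 2)], vector [\<psi> $ 2, cnj (\<psi> $ 1)]]"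
  have "braket \<psi> \<psi> = 1"
    using assms by (simp add: braket_self)
  then have n: "\<psi> $ 1 * cnj (\<psi> $ 1) + \<psi> $ 2 * cnj (\<psi> $ 2) = 1"
    by (simp add: braket_def sum_2 mult.commute)
  show "unitary U"
    using n by (simp add: unitary_def U_def cadj_def matrix_matrix_mult_def vec_eq_iff forall_2
        sum_2 mat_def algebra_simps)
  show "c *\<^sub>R ketbra \<psi> \<psi> = U ** rdiag (\<lambda>i. if i = 1 then c else 0) ** cadj U" for c
    by (simp add: U_def cadj_def matrix_matrix_mult_def vec_eq_iff forall_2
        sum_2 rdiag_def ketbra_def scaleR_conv_of_real [where 'a = complex] mult_ac)
qed

text \<open>
  For \<open>a \<noteq> 0\<close> the eigenvalue \<open>0\<close> on the orthogonal complement of \<open>\<psi>\<close> is preserved, so only the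
  scalar \<open>c\<close> is affected.
\<close>

lemma mpow_scaled_ketbra:
  fixes \<psi> :: "complex^2"
  assumes "norm \<psi> = 1" and "0 \<le> c" and "a \<noteq> 0"
  shows "mpow (c *\<^sub>R ketbra \<psi> \<psi>) a = rpow c a *\<^sub>R ketbra \<psi> \<psi>"
proof -
  obtain U where U: "unitary U"
    and diag: "\<And>c. c *\<^sub>R ketbra \<psi> \<psi> = U ** rdiag (\<lambda>i. if i = 1 then c else 0) ** cadj U"
    using scaled_ketbra_diagonalisation [OF assms(1)] by blast
  have "mpow (c *\<^sub>R ketbra \<psi> \<psi>) a =
      U ** rdiag (\<lambda>i. rpow (if i = 1 then c else 0) a) ** cadj U"
    using U assms(2) diag by (intro mpow_eqI) auto
  also have "(\<lambda>i::2. rpow (if i = 1 then c else 0) a) = (\<lambda>i. if i = 1 then rpow c a else 0)"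
    using assms(3) by (auto simp: rpow_def)
  finally show ?thesis
    by (simp add: diag)
qed

lemma mpow_scaled_ketbra_zero:
  fixes \<psi> :: "complex^2"
  assumes "norm \<psi> = 1" and "0 \<le> c"
  shows "mpow (c *\<^sub>R ketbra \<psi> \<psi>) 0 = mat 1"
proof -
  obtain U where U: "unitary U"
    and diag: "\<And>c. c *\<^sub>R ketbra \<psi> \<psi> = U ** rdiag (\<lambda>i. if i = 1 then c else 0) ** cadj U"
    using scaled_ketbra_diagonalisation [OF assms(1)] by blast
  have "mpow (c *\<^sub>R ketbra \<psi> \<psi>) 0 =
      U ** rdiag (\<lambda>i. rpow (if i = 1 then c else 0) 0) ** cadj U"
    using U assms(2) diag by (intro mpow_eqI) auto
  also have "rdiag (\<lambda>i::2. rpow (if i = 1 then c else 0) 0) = mat 1"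
    by (simp add: rpow_def rdiag_def mat_def cong: if_cong)
  finally show ?thesis
    using U by (simp add: unitary_def)
qed

corollary mpow_ketbra:
  fixes \<psi> :: "complex^2"
  assumes "norm \<psi> = 1" and "a \<noteq> 0"
  shows "mpow (ketbra \<psi> \<psi>) a = ketbra \<psi> \<psi>"
  using mpow_scaled_ketbra [OF assms(1), of 1 a] assms(2) by (simp add: rpow_def)

lemma rpow_half: "0 \<le> p \<Longrightarrow> rpow p (1/2) = sqrt p"
  by (simp add: rpow_def powr_half_sqrt)

lemma rpow_sqrt_double: "0 \<le> p \<Longrightarrow> rpow (sqrt p) (2 * t) = rpow p t"
  by (simp add: rpow_def powr_half_sqrt [symmetric] powr_powr)

section \<open>Fidelities with a pure qubit state\<close>

text \<open>
  Writing \<open>P\<close> for the projector, \<open>P\<^sup>1\<^sup>/\<^sup>2\<close> and \<open>P\<^sup>-\<^sup>1\<^sup>/\<^sup>2\<close> are both \<open>P\<close>. The compression gives \<open>p P\<close>,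
  with square root \<open>\<surd>p P\<close>, which the outer factors \<open>P\<close> leave unchanged.
\<close>

lemma gmean_ketbra:
  fixes \<psi> :: "complex^2"
  assumes "norm \<psi> = 1" and "0 \<le> p" and "braket \<psi> (A *v \<psi>) = complex_of_real p"
  shows "gmean (ketbra \<psi> \<psi>) A = sqrt p *\<^sub>R ketbra \<psi> \<psi>"
  using assms
  by (simp add: gmean_def mpow_ketbra ketbra_compression mpow_scaled_ketbra rpow_half
      matrix_scalar_ac scalar_matrix_assoc [symmetric] ketbra_idempotent)

lemma F_U_ketbra:
  fixes \<psi> :: "complex^2"
  assumes "norm \<psi> = 1" and "0 \<le> p" and "braket \<psi> (A *v \<psi>) = complex_of_real p"
  shows "F_U (ketbra \<psi> \<psi>) A = complex_of_real (sqrt p)"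
  using assms
  by (simp add: F_U_def mpow_ketbra ketbra_compression mpow_scaled_ketbra rpow_half
      trace_scaleR trace_ketbra braket_self)

lemma F_M_ketbra:
  fixes \<psi> :: "complex^2"
  assumes "norm \<psi> = 1" and "0 \<le> p" and "braket \<psi> (A *v \<psi>) = complex_of_real p"
  shows "F_M (ketbra \<psi> \<psi>) A = complex_of_real (sqrt p)"
  using assms by (simp add: F_M_def gmean_ketbra trace_scaleR trace_ketbra braket_self)

text \<open>
  The exponent \<open>0\<close> stands apart: there the power is the identity and not a multiple of the
  projector. The trace against the projector is nevertheless \<open>1 = p\<^sup>0\<close>, even for \<open>p = 0\<close>.
\<close>

lemma F_spec_ketbra:
  fixes \<psi> :: "complex^2"
  assumes "norm \<psi> = 1" and "0 \<le> p" and "braket \<psi> (A *v \<psi>) = complex_of_real p"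
  shows "F_spec t (ketbra \<psi> \<psi>) A = complex_of_real (rpow p t)"
proof -
  have F: "F_spec t (ketbra \<psi> \<psi>) A =
      trace (ketbra \<psi> \<psi> ** mpow (sqrt p *\<^sub>R ketbra \<psi> \<psi>) (2 * t))"
    using assms by (simp add: F_spec_def mpow_ketbra gmean_ketbra)
  show ?thesis
  proof (cases "t = 0")
    case True
    then show ?thesis
      using assms F by (simp add: mpow_scaled_ketbra_zero trace_ketbra braket_self rpow_def)
  next
    case False
    then show ?thesis
      using assms F by (simp add: mpow_scaled_ketbra matrix_scalar_ac
          scalar_matrix_assoc [symmetric] ketbra_idempotent trace_scaleR trace_ketbra
          braket_self rpow_sqrt_double)
  qed
qed

section \<open>Bloch vectors\<close>

text \<open>
  The Pauli matrices are traceless, and \<open>Tr ((r \<cdot> \<sigma>) (s \<cdot> \<sigma>)) = 2 (r \<bullet> s)\<close> because distinct ones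
  multiply to traceless matrices while each squares to the identity.
\<close>

lemma trace_bloch_mult:
  "trace (((1/2) *\<^sub>R (mat 1 + pauli_dot r)) ** ((1/2) *\<^sub>R (mat 1 + pauli_dot s)))
    = complex_of_real (1/2 * (1 + r \<bullet> s))"
  by (simp add: trace_def matrix_matrix_mult_def sum_2 mat_def pauli_dot_def sigma_x_def
      sigma_y_def sigma_z_def inner_vec_def sum_3 complex_eq_iff field_simps)

text \<open>
  A unit Bloch vector is realised by the spinor \<open>(1 + r\<^sub>3, r\<^sub>1 + \<i> r\<^sub>2) / \<surd>(2 (1 + r\<^sub>3))\<close>, whose
  ratio of entries is the stereographic projection of \<open>r\<close> from the south pole. At the south pole
  itself the formula degenerates and the second basis vector takes its place.
\<close>

lemma pure_state_bloch_of_norm_1: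
  assumes "norm r = 1"
  shows "pure_state ((1/2) *\<^sub>R (mat 1 + pauli_dot r))"
proof -
  have r: "(r $ 1)\<^sup>2 + (r $ 2)\<^sup>2 + (r $ 3)\<^sup>2 = 1"
    using assms by (simp add: norm_vec_def L2_set_def sum_3)
  have "\<exists>\<psi>. norm \<psi> = 1 \<and> (1/2) *\<^sub>R (mat 1 + pauli_dot r) = ketbra \<psi> \<psi>"
  proof (cases "r $ 3 = -1")
    case True
    then have "r $ 1 = 0" "r $ 2 = 0"
      using r by (simp_all add: sum_power2_eq_zero_iff)
    then show ?thesis
      using True
      by (intro exI [of _ "vector [0, 1]"])
        (simp add: norm_vec_def L2_set_def sum_2 vec_eq_iff forall_2 ketbra_def mat_def
          pauli_dot_def sigma_x_def sigma_y_def sigma_z_def complex_eq_iff)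
  next
    case False
    have "(r $ 3)\<^sup>2 \<le> 1"
      using r zero_le_power2 [of "r $ 1"] zero_le_power2 [of "r $ 2"] by linarith
    then have "\<bar>r $ 3\<bar> \<le> 1"
      by (simp add: abs_square_le_1)
    with False have pos: "0 < 1 + r $ 3"
      by linarith
    define q where "q = sqrt (2 * (1 + r $ 3))"
    have q: "q \<noteq> 0" "q * q = 2 * (1 + r $ 3)"
      using pos by (simp_all add: q_def)
    define \<psi> :: "complex^2" where
      "\<psi> = vector [complex_of_real ((1 + r $ 3) / q), Complex (r $ 1 / q) (r $ 2 / q)]"
    have cancel: "x / q * ((1 + r $ 3) / q) = x / 2" for x
      using pos by (simp add: q divide_simps)
    have outer: "r $ 1 / q * (r $ 1 / q) + r $ 2 / q * (r $ 2 / q) = (1 - r $ 3) / 2"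
    proof -
      have "r $ 1 / q * (r $ 1 / q) + r $ 2 / q * (r $ 2 / q)
          = ((r $ 1)\<^sup>2 + (r $ 2)\<^sup>2) / (q * q)"
        by (simp add: power2_eq_square add_divide_distrib)
      also have "(r $ 1)\<^sup>2 + (r $ 2)\<^sup>2 = (1 - r $ 3) * (1 + r $ 3)"
        using r by (simp add: power2_eq_square algebra_simps)
      also have "\<dots> / (q * q) = (1 - r $ 3) / 2"
        using cancel [of "1 - r $ 3"] by simp
      finally show ?thesis .
    qed
    have swapped: "(1 + r $ 3) / q * (x / q) = x / 2" for x
      using cancel [of x] by (simp only: mult.commute)
    have eq: "(1/2) *\<^sub>R (mat 1 + pauli_dot r) = ketbra \<psi> \<psi>"
      by (simp add: cancel swapped outer vec_eq_iff forall_2 ketbra_def mat_def \<psi>_def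
          pauli_dot_def sigma_x_def sigma_y_def sigma_z_def complex_eq_iff
          del: times_divide_eq_left times_divide_eq_right times_divide_times_eq)
    have "trace ((1/2) *\<^sub>R (mat 1 + pauli_dot r)) = 1"
      using state_bloch [of r] assms by (simp add: state_def)
    then have "complex_of_real ((norm \<psi>)\<^sup>2) = 1"
      by (simp only: eq trace_ketbra braket_self)
    then have "(norm \<psi>)\<^sup>2 = 1"
      by (simp only: of_real_eq_1_iff)
    then have "norm \<psi> = 1"
      using norm_ge_zero [of \<psi>] by (simp only: power2_eq_1_iff) linarith
    with eq show ?thesis
      by blast
  qed
  then show ?thesis
    by (simp add: pure_state_def)
qed

text \<open>Conversely, a pure state has purity \<open>Tr \<rho>\<^sup>2 = 1\<close>, and the purity is \<open>(1 + |r|\<^sup>2) / 2\<close>.\<close>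

lemma pure_state_bloch_iff:
  "pure_state ((1/2) *\<^sub>R (mat 1 + pauli_dot r)) \<longleftrightarrow> norm r = 1" (is "pure_state ?\<rho> \<longleftrightarrow> _")
proof
  assume "pure_state ?\<rho>"
  then obtain \<psi> where \<psi>: "norm \<psi> = 1" "?\<rho> = ketbra \<psi> \<psi>"
    by (auto simp: pure_state_def)
  then have "trace (?\<rho> ** ?\<rho>) = 1"
    by (simp only: ketbra_idempotent trace_ketbra braket_self) simp
  then have "complex_of_real (1/2 * (1 + r \<bullet> r)) = complex_of_real 1"
    by (simp only: trace_bloch_mult of_real_1)
  then have "1/2 * (1 + r \<bullet> r) = 1"
    by (simp only: of_real_eq_iff)
  then show "norm r = 1"
    by (simp add: norm_eq_1)
qed (rule pure_state_bloch_of_norm_1)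

theorem corollary4p2:
  fixes r s :: "real^3" and \<rho> \<sigma> :: "complex^2^2" and t :: real
  assumes "state \<rho>" and "state \<sigma>"
    and "\<rho> = (1/2) *\<^sub>R (mat 1 + pauli_dot r)"
    and "\<sigma> = (1/2) *\<^sub>R (mat 1 + pauli_dot s)"
    and "norm r \<le> 1" and "norm s \<le> 1"
    and "0 \<le> t" and "t \<le> 1"
  shows "(pure_state \<rho> \<longleftrightarrow> norm r = 1) \<and> (pure_state \<sigma> \<longleftrightarrow> norm s = 1) \<and>
    (pure_state \<rho> \<longrightarrow>
      trace (\<rho> ** \<sigma>)
        = 1/4 * trace (mat 1 + pauli_dot r + pauli_dot s + pauli_dot r ** pauli_dot s) \<and>
      trace (\<rho> ** \<sigma>) = complex_of_real (1/2 * (1 + r \<bullet> s)) \<and>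
      (\<forall>\<psi>. \<rho> = ketbra \<psi> \<psi> \<longrightarrow> trace (\<rho> ** \<sigma>) = braket \<psi> (\<sigma> *v \<psi>)) \<and>
      F_U \<rho> \<sigma> = complex_of_real (sqrt ((1 + r \<bullet> s) / 2)) \<and>
      F_M \<rho> \<sigma> = complex_of_real (sqrt ((1 + r \<bullet> s) / 2)) \<and>
      F_spec t \<rho> \<sigma> = complex_of_real (rpow ((1 + r \<bullet> s) / 2) t)) \<and>
    (\<forall>\<theta>. pure_state \<rho> \<and> pure_state \<sigma> \<and> 0 \<le> \<theta> \<and> \<theta> \<le> pi \<and> r \<bullet> s = cos \<theta> \<longrightarrow>
      F_U \<rho> \<sigma> = complex_of_real (cos (\<theta> / 2)) \<and>
      F_spec t \<rho> \<sigma> = complex_of_real (rpow (cos (\<theta> / 2)) (2 * t)))"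
proof -
  define p where "p = (1 + r \<bullet> s) / 2"
  have "\<bar>r \<bullet> s\<bar> \<le> norm r * norm s"
    by (rule Cauchy_Schwarz_ineq2)
  also have "\<dots> \<le> 1"
    using assms by (simp add: mult_le_one)
  finally have p: "0 \<le> p"
    by (simp add: p_def)
  have tr: "trace (\<rho> ** \<sigma>) = complex_of_real p"
    by (simp only: assms(3,4) trace_bloch_mult p_def) simp
  have expand: "trace (\<rho> ** \<sigma>)
      = 1/4 * trace (mat 1 + pauli_dot r + pauli_dot s + pauli_dot r ** pauli_dot s)"
    unfolding assms(3,4)
    by (simp add: trace_def matrix_matrix_mult_def sum_2 mat_def algebra_simps
        scaleR_conv_of_real [where 'a = complex])
  have pure: "F_U \<rho> \<sigma> = complex_of_real (sqrt p) \<and> F_M \<rho> \<sigma> = complex_of_real (sqrt p) \<and>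
      F_spec t \<rho> \<sigma> = complex_of_real (rpow p t)" if pure_\<rho>: "pure_state \<rho>"
  proof -
    obtain \<psi> where \<psi>: "norm \<psi> = 1" "\<rho> = ketbra \<psi> \<psi>"
      using pure_\<rho> by (auto simp: pure_state_def)
    have "braket \<psi> (\<sigma> *v \<psi>) = complex_of_real p"
      using tr by (simp add: \<psi>(2) trace_ketbra_mult)
    then show ?thesis
      using \<psi> p by (simp add: F_U_ketbra F_M_ketbra F_spec_ketbra)
  qed
  have angle: "F_U \<rho> \<sigma> = complex_of_real (cos (\<theta> / 2)) \<and>
      F_spec t \<rho> \<sigma> = complex_of_real (rpow (cos (\<theta> / 2)) (2 * t))"
    if "pure_state \<rho>" "0 \<le> \<theta>" "\<theta> \<le> pi" "r \<bullet> s = cos \<theta>" for \<theta>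
  proof -
    have "0 \<le> cos (\<theta> / 2)"
      using that by (intro cos_ge_zero) auto
    moreover have "p = (cos (\<theta> / 2))\<^sup>2"
      using cos_double_cos [of "\<theta> / 2"] that(4) by (simp add: p_def)
    ultimately have half: "sqrt p = cos (\<theta> / 2)"
      by simp
    show ?thesis
      using pure [OF that(1)] rpow_sqrt_double [OF p, of t] by (simp add: half)
  qed
  have "pure_state \<rho> \<longleftrightarrow> norm r = 1" "pure_state \<sigma> \<longleftrightarrow> norm s = 1"
    unfolding assms(3,4) by (rule pure_state_bloch_iff)+
  moreover have "trace (\<rho> ** \<sigma>) = complex_of_real (1/2 * (1 + r \<bullet> s))"
    by (simp add: tr p_def)
  moreover have "\<forall>\<psi>. \<rho> = ketbra \<psi> \<psi> \<longrightarrow> trace (\<rho> ** \<sigma>) = braket \<psi> (\<sigma> *v \<psi>)"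
    by (simp add: trace_ketbra_mult)
  ultimately show ?thesis
    using expand pure angle unfolding p_def by blast
qed

end
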